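(* Let $\mathcal{A}$ and $\mathcal{B}$ be two complex unital Banach algebras and let $\mathcal{T}\colon\mathcal{A}\to\mathcal{B}$ be a (not necessarily continuous) algebra homomorphism. Let $a\in\mathcal{A}$ and $b\in\mathcal{B}$ be such that $\mathcal{T}(a)=b$. Then the following statements hold. (i) Suppose that there exists an idempotent $p\in\mathcal{A}$, $p\notin N(\mathcal{T})$, such that, with $q=\mathcal{T}(p)$, $p'=1-p$, $q'=1-q$: $pa(1-p)\in N(\mathcal{T})$ and $(1-p)ap\in N(\mathcal{T})$, $(1-p)a(1-p)\in\Phi_{\mathcal{T}_{p',q'}}(p'\mathcal{A}p')$, and $pap\in\mathscr{R}_{\mathcal{T}}(\mathcal{A})$ (respectively $pap\in\mathscr{N}_{\mathcal{T}}(\mathcal{A})$; respectively $pap\in\mathscr{R}_{\mathcal{T}}(\mathcal{A})\setminus\mathscr{N}_{\mathcal{T}}(\mathcal{A})$). Then $b$ is Koliha-Drazin invertible but not invertible (respectively $b$ is Drazin invertible but not invertible; respectively $b$ is Koliha-Drazin invertible but not Drazin invertible). (ii) Suppose that $b$ is Koliha-Drazin invertible but not invertible (respectively Drazin invertible but not invertible; respectively Koliha-Drazin invertible but not Drazin invertible) and let $q\in\mathcal{B}$ be the spectral idempotent of $b$ corresponding to $0$. If there exists an idempotent $p\in\mathcal{A}$ such that $\mathcal{T}(p)=q$, then, with $p'=1-p$ and $q'=1-q$: $p\notin N(\mathcal{T})$, $pa(1-p)\in N(\mathcal{T})$ and $(1-p)ap\in N(\mathcal{T})$, $(1-p)a(1-p)\in\Phi_{\mathcal{T}_{p',q'}}(p'\mathcal{A}p')$,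 and $pap\in\mathscr{R}_{\mathcal{T}}(\mathcal{A})$ (respectively $pap\in\mathscr{N}_{\mathcal{T}}(\mathcal{A})$; respectively $pap\in\mathscr{R}_{\mathcal{T}}(\mathcal{A})\setminus\mathscr{N}_{\mathcal{T}}(\mathcal{A})$).
   Context: Algebra homomorphisms between unital Banach algebras are unital ($\mathcal{T}(1)=1$) and need not be continuous; $N(\mathcal{T})$ is the kernel. For an idempotent $e\ne 0$ of a unital Banach algebra $\mathcal{D}$, $e\mathcal{D}e$ is a unital Banach algebra with unit $e$ (if $e=0$ it is the zero algebra, in which $0$ is regarded as invertible). For $p\in\mathcal{A}$ idempotent and $q=\mathcal{T}(p)$, put $p'=1-p$, $q'=1-q$, and let $\mathcal{T}_{p',q'}\colon p'\mathcal{A}p'\to q'\mathcal{B}q'$ be the restriction of $\mathcal{T}$. $\Phi_{\mathcal{T}_{p',q'}}(p'\mathcal{A}p')=\{x\in p'\mathcal{A}p'\colon \mathcal{T}(x)\text{ is invertible in } q'\mathcal{B}q'\}$ (Fredholm elements relative to $\mathcal{T}_{p',q'}$). $\mathscr{R}_{\mathcal{T}}(\mathcal{A})=\{x\in\mathcal{A}\colon\mathcal{T}(x)\text{ is quasi-nilpotent in }\mathcal{B}\}$ (Riesz elements relative to $\mathcal{T}$). $\mathscr{N}_{\mathcal{T}}(\mathcal{A})=\{x\in\mathcal{A}\colon \exists k\in\mathbb{N},\ k\ge1,\ x^k\in N(\mathcal{T})\}$ ($\mathcal{T}$-nilpotent elements). An element $b$ of a unital Banach algebra $\mathcal{B}$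 is Drazin invertible if there exist $c\in\mathcal{B}$ and $m\in\mathbb{N}$ with $bc=cb$, $cbc=c$, $b^mcb=b^m$. It is Koliha-Drazin (generalized Drazin) invertible if there exists $c\in\mathcal{B}$ with $bc=cb$, $cbc=c$ and $bcb=b+w$ for some quasi-nilpotent $w\in\mathcal{B}$. An element $b\in\mathcal{B}$ that is Koliha-Drazin invertible but not invertible has $0$ as an isolated point of its spectrum; the spectral idempotent of $b$ corresponding to $0$ is the idempotent $0\neq q=q^2\in\mathcal{B}$ such that $bq=qb$, $bq$ is quasi-nilpotent and $b+q$ is invertible in $\mathcal{B}$. *)

theory Defs
  imports "HOL-Analysis.Analysis"
begin

text \<open>
  Complex unital Banach algebras. The real structure required by the superclasses is the
  restriction of the complex one. The normalisation \<open>norm 1 = 1\<close> is deliberately not assumed: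
  for an idempotent \<open>e\<close> the algebra \<open>e D e\<close> should count as a unital Banach algebra,
  although \<open>norm e\<close> may exceed 1.
\<close>

class complex_unital_banach_algebra = real_algebra_1 + real_normed_algebra + banach +
  fixes scaleC :: "complex \<Rightarrow> 'a \<Rightarrow> 'a"  (infixr \<open>*\<^sub>C\<close> 75)
  assumes scaleC_add_right: "c *\<^sub>C (x + y) = c *\<^sub>C x + c *\<^sub>C y"
    and scaleC_add_left: "(c + d) *\<^sub>C x = c *\<^sub>C x + d *\<^sub>C x"
    and scaleC_scaleC: "c *\<^sub>C (d *\<^sub>C x) = (c * d) *\<^sub>C x"
    and scaleC_of_real: "complex_of_real r *\<^sub>C x = r *\<^sub>R x"
    and mult_scaleC_left: "(c *\<^sub>C x) * y = c *\<^sub>C (x * y)"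
    and mult_scaleC_right: "x * (c *\<^sub>C y) = c *\<^sub>C (x * y)"
    and norm_scaleC: "norm (c *\<^sub>C x) = cmod c * norm x"

definition algebra_hom ::
  "('a::complex_unital_banach_algebra \<Rightarrow> 'b::complex_unital_banach_algebra) \<Rightarrow> bool" where
  "algebra_hom T \<longleftrightarrow>
     (\<forall>x y. T (x + y) = T x + T y) \<and>
     (\<forall>c x. T (c *\<^sub>C x) = c *\<^sub>C T x) \<and>
     (\<forall>x y. T (x * y) = T x * T y) \<and>
     T 1 = 1"

definition hom_kernel :: "('a \<Rightarrow> 'b::zero) \<Rightarrow> 'a set" where
  "hom_kernel T = {x. T x = 0}"

definition invertible_elem :: "'a::monoid_mult \<Rightarrow> bool" where
  "invertible_elem b \<longleftrightarrow> (\<exists>c. b * c = 1 \<and> c * b = 1)"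

definition spectrum :: "'a::complex_unital_banach_algebra \<Rightarrow> complex set" where
  "spectrum b = {z. \<not> invertible_elem (b - z *\<^sub>C 1)}"

definition quasinilpotent :: "'a::complex_unital_banach_algebra \<Rightarrow> bool" where
  "quasinilpotent b \<longleftrightarrow> spectrum b = {0}"

definition corner :: "'a::ring_1 \<Rightarrow> 'a set" where
  "corner e = {e * x * e | x. True}"

text \<open>
  Invertibility relative to the unit \<open>e\<close> of \<open>corner e\<close>. For \<open>e = 0\<close> the corner is the zero
  algebra and its element 0 is invertible.
\<close>

definition corner_invertible :: "'a::ring_1 \<Rightarrow> 'a \<Rightarrow> bool" where
  "corner_invertible e x \<longleftrightarrow>
     x \<in> corner e \<and> (\<exists>y\<in>corner e. x * y = e \<and> y * x = e)"

text \<open>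
  Fredholm elements of \<open>corner e\<close> relative to the restriction of \<open>T\<close> to a map
  from \<open>corner e\<close> to \<open>corner f\<close>.
\<close>

definition corner_fredholm ::
  "('a::complex_unital_banach_algebra \<Rightarrow> 'b::complex_unital_banach_algebra)
    \<Rightarrow> 'a \<Rightarrow> 'b \<Rightarrow> 'a set" where
  "corner_fredholm T e f = {x \<in> corner e. corner_invertible f (T x)}"

definition riesz_elements ::
  "('a::complex_unital_banach_algebra \<Rightarrow> 'b::complex_unital_banach_algebra) \<Rightarrow> 'a set" where
  "riesz_elements T = {x. quasinilpotent (T x)}"

definition hom_nilpotents ::
  "('a::complex_unital_banach_algebra \<Rightarrow> 'b::complex_unital_banach_algebra) \<Rightarrow> 'a set" where
  "hom_nilpotents T = {x. \<exists>k\<ge>1. x ^ k \<in> hom_kernel T}"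

definition drazin_invertible :: "'a::complex_unital_banach_algebra \<Rightarrow> bool" where
  "drazin_invertible b \<longleftrightarrow>
     (\<exists>c m. b * c = c * b \<and> c * b * c = c \<and> b ^ m * c * b = b ^ m)"

definition koliha_drazin_invertible :: "'a::complex_unital_banach_algebra \<Rightarrow> bool" where
  "koliha_drazin_invertible b \<longleftrightarrow>
     (\<exists>c w. b * c = c * b \<and> c * b * c = c \<and> quasinilpotent w \<and> b * c * b = b + w)"

text \<open>
  The spectral idempotent \<open>q\<close> of \<open>b\<close> corresponding to 0, as a relation: for \<open>b\<close> that is
  Koliha-Drazin invertible but not invertible these conditions determine \<open>q\<close> uniquely.
\<close>

definition spectral_idempotent_at_0 ::
  "'a::complex_unital_banach_algebra \<Rightarrow> 'a \<Rightarrow> bool" where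
  "spectral_idempotent_at_0 b q \<longleftrightarrow>
     q \<noteq> 0 \<and> q * q = q \<and> b * q = q * b \<and> quasinilpotent (b * q) \<and> invertible_elem (b + q)"

end

theory Submission
  imports Defs
begin

text \<open>
  Put \<open>q = T p\<close>. Applying \<open>T\<close> turns the conditions on \<open>p\<close> into conditions on \<open>b\<close> and \<open>q\<close>
  alone: the off-diagonal conditions say that \<open>b\<close> commutes with \<open>q\<close>, the Fredholm condition
  says that \<open>b\<close> is invertible on the corner of \<open>1 - q\<close>, and the last condition says that
  \<open>b * q\<close> is quasi-nilpotent or nilpotent. Given such a \<open>q\<close>, the inverse \<open>c\<close> of \<open>b\<close> on the
  corner of \<open>1 - q\<close> satisfies \<open>b * c = c * b = 1 - q\<close>, and so it is a Koliha-Drazin or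
  Drazin inverse of \<open>b\<close>. Conversely, for the spectral idempotent \<open>q\<close> the inverse of \<open>b + q\<close>
  cut down by \<open>1 - q\<close> inverts \<open>b\<close> on that corner.

  What remains is that, for an idempotent \<open>q\<close> commuting with \<open>b\<close> and \<open>b * q\<close> quasi-nilpotent, \<open>b\<close> is not
  invertible unless \<open>q = 0\<close>, and \<open>b * q\<close> is nilpotent if \<open>b\<close> is Drazin invertible. Both follow
  from \<open>q * (b * d) = 0\<close> whenever \<open>d\<close> commutes with \<open>b\<close> and \<open>d * b * d = d\<close>
  (\<open>quasinilpotent_idempotent_times_inverse\<close>): this product equals \<open>(b * q) ^ n * d ^ n\<close> for
  all \<open>n > 0\<close>, and these tend to \<open>0\<close>.

  That limit is the only analytic input. Quasi-nilpotence is defined by the spectrum, so it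
  needs the part of the spectral radius formula saying that \<open>norm (x ^ n)\<close> decays faster than
  every geometric sequence when the spectrum of \<open>x\<close> is \<open>{0}\<close>
  (\<open>quasinilpotent_scaled_powers_tendsto_0\<close>). It is proved by Rickart's elementary method,
  which replaces Cauchy's integral formula by averages of the resolvent over roots of unity.
\<close>

section \<open>Elementary facts about complex unital Banach algebras\<close>

lemma scaleC_one: "1 *\<^sub>C x = (x::'a::complex_unital_banach_algebra)"
  using scaleC_of_real[of 1 x] by simp

lemma scaleC_zero_right: "c *\<^sub>C (0::'a::complex_unital_banach_algebra) = 0"
  using scaleC_add_right[of c 0 "0::'a"] by simp

lemma scaleC_zero_left: "0 *\<^sub>C x = (0::'a::complex_unital_banach_algebra)"
  using scaleC_of_real[of 0 x] by simp

lemma scaleC_minus_left: "(- c) *\<^sub>C x = - (c *\<^sub>C (x::'a::complex_unital_banach_algebra))"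
  using scaleC_add_left[of "-c" c x] by (simp add: scaleC_zero_left eq_neg_iff_add_eq_0)

lemma scaleC_minus_right: "c *\<^sub>C (- x) = - (c *\<^sub>C (x::'a::complex_unital_banach_algebra))"
  using scaleC_add_right[of c "-x" x] by (simp add: scaleC_zero_right eq_neg_iff_add_eq_0)

lemma scaleC_diff_left:
  "(c - d) *\<^sub>C x = c *\<^sub>C x - d *\<^sub>C (x::'a::complex_unital_banach_algebra)"
  using scaleC_add_left[of c "-d" x] by (simp add: scaleC_minus_left)

lemma scaleC_diff_right:
  "c *\<^sub>C (x - y) = c *\<^sub>C x - c *\<^sub>C (y::'a::complex_unital_banach_algebra)"
  using scaleC_add_right[of c x "-y"] by (simp add: scaleC_minus_right)

lemma scaleC_sum_left:
  "(\<Sum>i\<in>I. f i) *\<^sub>C x = (\<Sum>i\<in>I. f i *\<^sub>C (x::'a::complex_unital_banach_algebra))"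
  by (induction I rule: infinite_finite_induct)
     (simp_all add: scaleC_zero_left scaleC_add_left)

lemma scaleC_power:
  "(c *\<^sub>C x) ^ n = c ^ n *\<^sub>C (x::'a::complex_unital_banach_algebra) ^ n"
  by (induction n)
     (simp_all add: scaleC_one mult_scaleC_left mult_scaleC_right scaleC_scaleC mult.commute)

lemma norm_power_le:
  "norm ((x::'a::complex_unital_banach_algebra) ^ n) \<le> norm x ^ n * norm (1::'a)"
proof (induction n)
  case (Suc n)
  have "norm (x ^ Suc n) \<le> norm x * norm (x ^ n)"
    by (simp add: norm_mult_ineq)
  also have "\<dots> \<le> norm x * (norm x ^ n * norm (1::'a))"
    by (intro mult_left_mono Suc) simp
  finally show ?case by (simp add: mult.assoc)
qed simp

lemma inverse_commutes:
  fixes g u x :: "'a::monoid_mult"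
  assumes "u * g = 1" "g * u = 1" "u * x = x * u"
  shows "x * g = g * x"
proof -
  have "x * g = (g * u) * x * g" using assms(2) by simp
  also have "\<dots> = g * (x * u) * g" by (simp only: assms(3) mult.assoc)
  also have "\<dots> = g * x" using assms(1) by (simp add: mult.assoc)
  finally show ?thesis .
qed

text \<open>Inversion is close to the identity near \<open>1\<close>; the factor \<open>norm 1\<close> appears because the
  norm is not normalised.\<close>

lemma norm_inverse_minus_one_le:
  fixes F u :: "'a::complex_unital_banach_algebra"
  assumes "F * u = 1" and c: "norm (u - 1) \<le> c" "c \<le> 1/2"
  shows "norm (F - 1) \<le> 2 * norm (1::'a) * c"
proof -
  have "F - 1 = F * (1 - u)"
    using assms(1) by (simp add: algebra_simps)
  hence "norm (F - 1) \<le> norm F * norm (1 - u)"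
    by (simp add: norm_mult_ineq)
  also have "\<dots> \<le> norm F * c"
    using c by (intro mult_left_mono) (simp_all add: norm_minus_commute)
  also have "\<dots> \<le> (norm (F - 1) + norm (1::'a)) * c"
  proof (rule mult_right_mono)
    show "norm F \<le> norm (F - 1) + norm (1::'a)"
      using norm_triangle_ineq[of "F - 1" 1] by simp
    show "0 \<le> c" using c norm_ge_zero[of "u - 1"] by linarith
  qed
  also have "\<dots> = norm (F - 1) * c + norm (1::'a) * c" by (simp add: algebra_simps)
  also have "norm (F - 1) * c \<le> norm (F - 1) * (1/2)"
    using c by (intro mult_left_mono) auto
  finally show ?thesis by simp
qed

section \<open>Powers of quasi-nilpotent elements\<close>

lemma sum_powers_root_of_unity:
  assumes "0 < j" "j < n"
  shows "(\<Sum>k<n. (cis (2 * pi / real n) ^ k) ^ j) = 0"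
proof -
  define w where "w = cis (2 * pi / real n) ^ j"
  have n: "n > 0" using assms by simp
  have w: "w = cis (2 * pi * real j / real n)"
    unfolding w_def Complex.DeMoivre by (simp add: mult_ac)
  have "w \<noteq> 1"
  proof
    assume "w = 1"
    hence "cis (2 * pi * real j / real n) = cis (2 * pi * real 0 / real n)"
      using w by simp
    with Complex.bij_betw_roots_unity[OF n] assms show False
      unfolding bij_betw_def inj_on_def by (metis lessThan_iff n less_irrefl)
  qed
  moreover have "w ^ n = 1"
    unfolding w Complex.DeMoivre using n cis_multiple_2pi[of "real j"] by (simp add: mult_ac)
  ultimately have "(\<Sum>k<n. w ^ k) = 0"
    by (simp add: geometric_sum)
  thus ?thesis
    by (simp add: w_def power_mult[symmetric] mult.commute)
qed

text \<open>The average of the resolvents \<open>(1 - \<omega> y)\<inverse>\<close> over the \<open>n\<close>-th roots of unity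
  \<open>\<omega>\<close> is a right inverse of \<open>1 - y ^ n\<close>: multiplying each resolvent by \<open>1 - (\<omega> y) ^ n\<close>
  gives a finite geometric sum, and averaging over \<open>\<omega>\<close> leaves its constant term.\<close>

lemma average_resolvents_roots_of_unity:
  fixes y :: "'a::complex_unital_banach_algebra"
  assumes n: "n > 0"
    and g: "\<And>k. (1 - (cis (2 * pi / real n) ^ k) *\<^sub>C y) * g k = 1"
  shows "(1 - y ^ n) * ((1 / real n) *\<^sub>R (\<Sum>k<n. g k)) = 1"
proof -
  define r where "r = cis (2 * pi / real n)"
  have rn: "(r ^ k) ^ n = 1" for k
  proof -
    have "r ^ n = 1"
      unfolding r_def Complex.DeMoivre using n by simp
    thus ?thesis by (metis mult.commute power_mult power_one)
  qed
  have G: "(1 - y ^ n) * g k = (\<Sum>j<n. (r ^ k) ^ j *\<^sub>C y ^ j)" for k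
  proof -
    define u where "u = (r ^ k) *\<^sub>C y"
    have geo: "(\<Sum>j<m. u ^ j) * (1 - u) = 1 - u ^ m" for m
    proof (induction m)
      case (Suc m)
      have "(\<Sum>j<Suc m. u ^ j) * (1 - u) = (\<Sum>j<m. u ^ j) * (1 - u) + u ^ m * (1 - u)"
        by (simp only: sum.lessThan_Suc distrib_right)
      also have "\<dots> = 1 - u ^ Suc m"
        unfolding Suc by (simp add: right_diff_distrib power_commutes)
      finally show ?case .
    qed simp
    have "u ^ n = y ^ n"
      by (simp add: u_def scaleC_power rn scaleC_one)
    hence "(1 - y ^ n) * g k = (\<Sum>j<n. u ^ j) * ((1 - u) * g k)"
      using geo[of n] by (simp add: mult.assoc[symmetric])
    also have "\<dots> = (\<Sum>j<n. u ^ j)"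
      using g[of k] by (simp add: u_def r_def)
    finally show ?thesis by (simp add: u_def scaleC_power)
  qed
  have "(1 - y ^ n) * (\<Sum>k<n. g k) = (\<Sum>k<n. \<Sum>j<n. (r ^ k) ^ j *\<^sub>C y ^ j)"
    by (simp add: sum_distrib_left G)
  also have "\<dots> = (\<Sum>j<n. (\<Sum>k<n. (r ^ k) ^ j) *\<^sub>C y ^ j)"
    by (subst sum.swap) (simp add: scaleC_sum_left)
  also have "\<dots> = (\<Sum>j<n. if j = 0 then real n *\<^sub>R 1 else 0)"
  proof (rule sum.cong)
    fix j assume "j \<in> {..<n}"
    thus "(\<Sum>k<n. (r ^ k) ^ j) *\<^sub>C y ^ j = (if j = 0 then real n *\<^sub>R 1 else 0)"
      using sum_powers_root_of_unity[of j n] scaleC_of_real[of "real n" "1::'a"]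
      by (auto simp: r_def scaleC_zero_left)
  qed simp
  also have "\<dots> = real n *\<^sub>R 1"
    using n by simp
  finally show ?thesis using n by simp
qed

text \<open>The resolvent identity gives the continuity of the resolvent without any expansion
  into a Neumann series, since the inverses are assumed to exist.\<close>

lemma continuous_resolvent:
  fixes x :: "'a::complex_unital_banach_algebra"
  assumes g1: "\<And>z. (1 - z *\<^sub>C x) * g z = 1" and g2: "\<And>z. g z * (1 - z *\<^sub>C x) = 1"
  shows "isCont g z"
proof -
  define K where "K = norm (x * g z)"
  have est: "norm (g y - g z) \<le> 2 * (cmod (y - z) * (norm (g z) * K))"
    if y: "cmod (y - z) * K < 1/2" for y
  proof -
    have "g y - g z = g y * ((1 - z *\<^sub>C x) - (1 - y *\<^sub>C x)) * g z"
    proof -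
      have "g y * ((1 - z *\<^sub>C x) - (1 - y *\<^sub>C x)) * g z =
        g y * ((1 - z *\<^sub>C x) * g z) - (g y * (1 - y *\<^sub>C x)) * g z"
        by (simp only: left_diff_distrib right_diff_distrib mult.assoc)
      thus ?thesis using g1[of z] g2[of y] by simp
    qed
    also have "\<dots> = (y - z) *\<^sub>C (g y * (x * g z))"
      by (simp add: scaleC_diff_left mult_scaleC_left mult_scaleC_right algebra_simps)
    finally have "norm (g y - g z) \<le> cmod (y - z) * (norm (g y) * K)"
      by (simp add: norm_scaleC K_def mult_left_mono norm_mult_ineq)
    also have "\<dots> \<le> cmod (y - z) * ((norm (g y - g z) + norm (g z)) * K)"
      using norm_triangle_ineq[of "g y - g z" "g z"]
      by (intro mult_left_mono mult_right_mono) (auto simp: K_def)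
    also have "\<dots> = norm (g y - g z) * (cmod (y - z) * K) + cmod (y - z) * (norm (g z) * K)"
      by (simp add: algebra_simps)
    also have "norm (g y - g z) * (cmod (y - z) * K) \<le> norm (g y - g z) * (1/2)"
      using y by (intro mult_left_mono) auto
    finally show ?thesis by simp
  qed
  have "((\<lambda>y. cmod (y - z) * K) \<longlongrightarrow> cmod (z - z) * K) (at z)"
    by (intro tendsto_intros)
  hence "eventually (\<lambda>y. cmod (y - z) * K < 1/2) (at z)"
    by (intro order_tendstoD(2)) auto
  hence ev: "eventually (\<lambda>y. norm (g y - g z) \<le> 2 * (cmod (y - z) * (norm (g z) * K))) (at z)"
    by eventually_elim (rule est)
  have "((\<lambda>y. 2 * (cmod (y - z) * (norm (g z) * K)))
          \<longlongrightarrow> 2 * (cmod (z - z) * (norm (g z) * K))) (at z)"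
    by (intro tendsto_intros)
  hence "((\<lambda>y. 2 * (cmod (y - z) * (norm (g z) * K))) \<longlongrightarrow> 0) (at z)" by simp
  from Lim_null_comparison[OF ev this] show ?thesis
    by (simp add: isCont_def LIM_zero_iff)
qed

lemma quasinilpotent_resolvent:
  fixes x :: "'a::complex_unital_banach_algebra"
  assumes "quasinilpotent x"
  obtains g where "\<And>z. (1 - z *\<^sub>C x) * g z = 1" "\<And>z. g z * (1 - z *\<^sub>C x) = 1"
proof -
  have "\<exists>c. (1 - z *\<^sub>C x) * c = 1 \<and> c * (1 - z *\<^sub>C x) = 1" for z
  proof (cases "z = 0")
    case True
    thus ?thesis by (simp add: scaleC_zero_left)
  next
    case False
    hence "1 / z \<notin> spectrum x"
      using assms by (simp add: quasinilpotent_def)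
    then obtain c where c: "(x - (1 / z) *\<^sub>C 1) * c = 1" "c * (x - (1 / z) *\<^sub>C 1) = 1"
      by (auto simp: spectrum_def invertible_elem_def)
    have eq: "1 - z *\<^sub>C x = (- z) *\<^sub>C (x - (1 / z) *\<^sub>C 1)"
      using False by (simp add: scaleC_diff_right scaleC_scaleC scaleC_minus_left scaleC_one)
    have "(1 - z *\<^sub>C x) * ((- 1 / z) *\<^sub>C c) = 1" "((- 1 / z) *\<^sub>C c) * (1 - z *\<^sub>C x) = 1"
      unfolding eq using False c
      by (simp_all add: mult_scaleC_left mult_scaleC_right scaleC_scaleC scaleC_one)
    thus ?thesis by blast
  qed
  thus ?thesis using that by metis
qed

text \<open>The half of the spectral radius formula that is needed. The resolvent is uniformly
  continuous on a large disc, so the averages over roots of unity, that is the inverses of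
  \<open>1 - (w x) ^ n\<close>, are equicontinuous in \<open>w\<close> uniformly in \<open>n\<close>. Hence \<open>(w x) ^ n\<close> tending
  to \<open>0\<close> propagates from \<open>w\<close> to \<open>w + h\<close> with a step \<open>h\<close> that does not depend on \<open>w\<close>.\<close>

lemma quasinilpotent_scaled_powers_tendsto_0:
  fixes x :: "'a::complex_unital_banach_algebra"
  assumes qn: "quasinilpotent x" and M: "M > 0"
  shows "(\<lambda>n. M ^ n * norm (x ^ n)) \<longlonglongrightarrow> 0"
proof -
  obtain g where g1: "\<And>z. (1 - z *\<^sub>C x) * g z = 1" and g2: "\<And>z. g z * (1 - z *\<^sub>C x) = 1"
    using quasinilpotent_resolvent[OF qn] by metis
  have "continuous_on (cball 0 (2 * M)) g"
    using continuous_resolvent[OF g1 g2] by (simp add: continuous_at_imp_continuous_on)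
  hence "uniformly_continuous_on (cball 0 (2 * M)) g"
    by (intro compact_uniformly_continuous) auto
  then obtain d where d: "d > 0"
    and dg: "\<And>y z. y \<in> cball 0 (2 * M) \<Longrightarrow> z \<in> cball 0 (2 * M) \<Longrightarrow> dist z y < d
               \<Longrightarrow> dist (g z) (g y) < 1/4"
    unfolding uniformly_continuous_on_def by (metis divide_pos_pos zero_less_numeral zero_less_one)
  define N1 where "N1 = norm (1::'a)"
  have N1: "N1 > 0" by (simp add: N1_def)
  define F where
    "F n w = (1 / real n) *\<^sub>R (\<Sum>k<n. g (cis (2 * pi / real n) ^ k * complex_of_real w))" for n w
  have F1: "(1 - (of_real w *\<^sub>C x) ^ n) * F n w = 1" if "n > 0" for n w
    unfolding F_def
    by (rule average_resolvents_roots_of_unity[OF that]) (simp add: scaleC_scaleC g1)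
  have F2: "F n w * (1 - (of_real w *\<^sub>C x) ^ n) = 1" if "n > 0" for n w
  proof -
    \<comment> \<open>The inverse is two-sided because every resolvent commutes with \<open>x\<close>.\<close>
    define y where "y = of_real w *\<^sub>C x"
    have comm: "x * g z = g z * x" for z
      by (rule inverse_commutes[OF g1 g2])
         (simp add: left_diff_distrib right_diff_distrib mult_scaleC_left mult_scaleC_right)
    have "x * F n w = F n w * x"
      by (simp add: F_def sum_distrib_left sum_distrib_right comm)
    hence "y * F n w = F n w * y"
      by (simp add: y_def mult_scaleC_left mult_scaleC_right)
    hence "y ^ n * F n w = F n w * y ^ n"
      by (rule power_commuting_commutes)
    thus ?thesis using F1[OF that, of w] by (simp add: algebra_simps y_def)
  qed
  have Fdiff: "norm (F n v - F n w) \<le> 1/4"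
    if "n > 0" "0 \<le> v" "v \<le> 2 * M" "0 \<le> w" "w \<le> 2 * M" "\<bar>v - w\<bar> < d" for n v w
  proof -
    define r where "r k = cis (2 * pi / real n) ^ k" for k
    have r: "cmod (r k) = 1" for k by (simp add: r_def norm_power)
    have k: "norm (g (r k * of_real v) - g (r k * of_real w)) \<le> 1/4" for k
    proof -
      have "dist (r k * complex_of_real v) (r k * of_real w) = \<bar>v - w\<bar>"
        using r[of k]
        by (metis dist_norm mult_1 norm_mult norm_of_real of_real_diff right_diff_distrib)
      with dg[of "r k * of_real w" "r k * of_real v"] r[of k] that
      show ?thesis by (auto simp: norm_mult dist_norm less_imp_le)
    qed
    have "norm (F n v - F n w) =
      (1 / real n) * norm (\<Sum>k<n. g (r k * of_real v) - g (r k * of_real w))"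
      unfolding F_def r_def[symmetric]
      by (simp add: scaleR_diff_right[symmetric] sum_subtractf[symmetric])
    also have "\<dots> \<le> (1 / real n) * (\<Sum>k<n. 1/4)"
      by (intro mult_left_mono order_trans[OF norm_sum] sum_mono k) simp
    also have "\<dots> = 1/4" using that by simp
    finally show ?thesis .
  qed
  have nrm: "norm ((of_real w *\<^sub>C x) ^ n) = w ^ n * norm (x ^ n)" if "w \<ge> 0" for w n
    using that by (simp add: scaleC_power norm_scaleC norm_power)
  have step: "(\<lambda>n. u ^ n * norm (x ^ n)) \<longlonglongrightarrow> 0"
    if w: "(\<lambda>n. w ^ n * norm (x ^ n)) \<longlonglongrightarrow> 0"
      and u: "0 \<le> w" "w < u" "u < v" "v \<le> 2 * M" "v - w < d" for u v w
  proof -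
    define c where "c = min (1/2) (1 / (8 * N1))"
    have c: "c > 0" "c \<le> 1/2" "2 * N1 * c \<le> 1/4"
      using N1 by (auto simp: c_def min_def field_simps)
    have "eventually (\<lambda>n. w ^ n * norm (x ^ n) < c) sequentially"
      using w c by (intro order_tendstoD(2)) auto
    \<comment> \<open>Powers at the auxiliary point \<open>v\<close> stay bounded, which forces decay at \<open>u < v\<close>.\<close>
    hence "eventually (\<lambda>n. v ^ n * norm (x ^ n) \<le> N1) sequentially"
      using eventually_gt_at_top[of 0]
    proof eventually_elim
      case (elim n)
      have "norm (F n w - 1) \<le> 2 * N1 * c"
        unfolding N1_def using elim c u
        by (intro norm_inverse_minus_one_le[OF F2[of n w]]) (simp_all add: nrm)
      moreover have "norm (F n v - F n w) \<le> 1/4"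
        using elim u by (intro Fdiff) auto
      ultimately have "norm (F n v - 1) \<le> 1/2"
        using norm_triangle_ineq[of "F n v - F n w" "F n w - 1"] c by simp
      from norm_inverse_minus_one_le[OF F1[of n v] this] elim u show ?case
        by (simp add: nrm N1_def)
    qed
    hence ev: "eventually (\<lambda>n. norm (u ^ n * norm (x ^ n)) \<le> (u / v) ^ n * N1) sequentially"
    proof eventually_elim
      case (elim n)
      have "u ^ n * norm (x ^ n) = (u / v) ^ n * (v ^ n * norm (x ^ n))"
        using u by (simp add: power_divide)
      also have "\<dots> \<le> (u / v) ^ n * N1"
        using u elim by (intro mult_left_mono) auto
      finally show ?case using u by simp
    qed
    have "(\<lambda>n. (u / v) ^ n * N1) \<longlonglongrightarrow> 0 * N1"
      using u by (intro tendsto_intros LIMSEQ_power_zero) auto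
    with ev show ?thesis by (intro Lim_null_comparison[OF ev]) simp
  qed
  \<comment> \<open>Reach \<open>M\<close> from \<open>0\<close> in \<open>m\<close> steps of length \<open>h\<close>; each auxiliary point lies \<open>2 * h\<close> ahead,
    hence inside the disc of radius \<open>2 * M\<close>.\<close>
  obtain m where m: "real m > 2 * M / d + 2"
    using reals_Archimedean2 by blast
  have m0: "real m > 2"
    using m M d by (smt (verit) divide_pos_pos)
  define h where "h = M / real m"
  have h: "h > 0" "2 * h < d" "2 * h \<le> M" "real m * h = M"
  proof -
    show "h > 0" "real m * h = M" using M m0 by (auto simp: h_def)
    have "2 * M / d < real m" using m by simp
    thus "2 * h < d" using d m0 by (simp add: h_def field_simps)
    have "2 * M \<le> real m * M" using m0 M by (intro mult_right_mono) auto
    thus "2 * h \<le> M" using m0 by (simp add: h_def field_simps)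
  qed
  have "(\<lambda>n. (real k * h) ^ n * norm (x ^ n)) \<longlonglongrightarrow> 0" if "k \<le> m" for k
    using that
  proof (induction k)
    case 0
    have "eventually (\<lambda>n. (real 0 * h) ^ n * norm (x ^ n) = 0) sequentially"
      using eventually_gt_at_top[of 0] by eventually_elim simp
    thus ?case by (rule tendsto_eventually)
  next
    case (Suc k)
    have "real k * h + h \<le> real m * h"
      using Suc.prems h mult_right_mono[of "real (Suc k)" "real m" h]
      by (simp add: distrib_right)
    hence v: "real k * h + 2 * h \<le> 2 * M" using h by linarith
    have "0 \<le> real k * h" using h by simp
    moreover have IH: "(\<lambda>n. (real k * h) ^ n * norm (x ^ n)) \<longlonglongrightarrow> 0"
      using Suc by simp
    ultimately have "(\<lambda>n. (real k * h + h) ^ n * norm (x ^ n)) \<longlonglongrightarrow> 0"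
      using h v by (intro step[OF IH, of _ "real k * h + 2 * h"]) linarith+
    thus ?case by (simp add: distrib_right add.commute)
  qed
  from this[of m] h show ?thesis by simp
qed

lemma quasinilpotent_power_mult_tendsto_0:
  fixes x d :: "'a::complex_unital_banach_algebra"
  assumes "quasinilpotent x"
  shows "(\<lambda>n. x ^ n * d ^ n) \<longlonglongrightarrow> 0"
proof -
  define K where "K = norm d + 1"
  have K: "K > 0" by (simp add: K_def add_nonneg_pos)
  have "norm (x ^ n * d ^ n) \<le> (K ^ n * norm (x ^ n)) * norm (1::'a)" for n
  proof -
    have "norm (x ^ n * d ^ n) \<le> norm (x ^ n) * norm (d ^ n)" by (rule norm_mult_ineq)
    also have "\<dots> \<le> norm (x ^ n) * (K ^ n * norm (1::'a))"
      by (intro mult_left_mono order_trans[OF norm_power_le] mult_right_mono power_mono)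
         (auto simp: K_def)
    finally show ?thesis by (simp add: mult_ac)
  qed
  hence ev: "eventually (\<lambda>n. norm (x ^ n * d ^ n) \<le> (K ^ n * norm (x ^ n)) * norm (1::'a)) sequentially"
    by simp
  have "(\<lambda>n. (K ^ n * norm (x ^ n)) * norm (1::'a)) \<longlonglongrightarrow> 0 * norm (1::'a)"
    by (intro tendsto_intros quasinilpotent_scaled_powers_tendsto_0 assms K)
  thus ?thesis by (intro Lim_null_comparison[OF ev]) simp
qed

section \<open>Drazin inverses and commuting idempotents\<close>

lemma quasinilpotent_minus:
  fixes x :: "'a::complex_unital_banach_algebra"
  assumes "quasinilpotent x"
  shows "quasinilpotent (- x)"
proof -
  have inv: "invertible_elem (- u) \<longleftrightarrow> invertible_elem u" for u :: 'a
    unfolding invertible_elem_def by (metis minus_mult_minus minus_minus)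
  have "- x - z *\<^sub>C 1 = - (x - (- z) *\<^sub>C 1)" for z
    by (simp add: scaleC_minus_left)
  hence "z \<in> spectrum (- x) \<longleftrightarrow> - z \<in> spectrum x" for z
    by (simp only: spectrum_def mem_Collect_eq inv)
  thus ?thesis using assms by (auto simp: quasinilpotent_def)
qed

text \<open>The idempotent \<open>b * d\<close> equals \<open>(b * d) ^ n\<close>, so \<open>q * (b * d) = (b * q) ^ n * d ^ n\<close>
  for every positive \<open>n\<close>, and these products tend to \<open>0\<close>.\<close>

lemma quasinilpotent_idempotent_times_inverse:
  fixes b q d :: "'a::complex_unital_banach_algebra"
  assumes q: "q * q = q" and bq: "b * q = q * b" and qn: "quasinilpotent (b * q)"
    and bd: "b * d = d * b" and dbd: "d * b * d = d"
  shows "q * (b * d) = 0"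
proof -
  have e: "(b * q) ^ Suc n * d ^ Suc n = q * (b * d)" for n
  proof (induction n)
    case (Suc n)
    have "(b * q) ^ Suc (Suc n) * d ^ Suc (Suc n) = b * q * ((b * q) ^ Suc n * d ^ Suc n) * d"
      by (simp add: power_commutes mult.assoc)
    also have "\<dots> = b * q * (q * (b * d)) * d" by (simp only: Suc)
    also have "\<dots> = q * b * (b * d * d)"
      using q bq by (metis mult.assoc)
    also have "\<dots> = q * (b * d)"
      using bd dbd by (metis mult.assoc)
    finally show ?case .
  qed (use bq in \<open>simp add: mult.assoc[symmetric]\<close>)
  have "(\<lambda>n. (b * q) ^ Suc n * d ^ Suc n) \<longlonglongrightarrow> 0"
    using quasinilpotent_power_mult_tendsto_0[OF qn] by (rule LIMSEQ_Suc)
  hence "(\<lambda>n::nat. q * (b * d)) \<longlonglongrightarrow> 0" by (simp only: e)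
  thus ?thesis by (simp only: LIMSEQ_const_iff)
qed

lemma power_mult_idempotent:
  fixes b q :: "'a::monoid_mult"
  assumes "q * q = q" "b * q = q * b"
  shows "(b * q) ^ Suc n = b ^ Suc n * q"
proof (induction n)
  case (Suc n)
  have "(b * q) ^ Suc (Suc n) = b * q * (b ^ Suc n * q)"
    by (subst power_Suc) (simp only: Suc)
  also have "\<dots> = b * (b ^ Suc n * q) * q"
    using power_commuting_commutes[OF assms(2), of "Suc n"] assms by (metis mult.assoc)
  also have "\<dots> = b ^ Suc (Suc n) * q"
    using assms by (simp add: mult.assoc)
  finally show ?case .
qed simp

text \<open>A Drazin inverse \<open>d\<close> gives \<open>b ^ Suc m = b * d * b ^ Suc m\<close>, and \<open>q\<close> annihilates
  \<open>b * d\<close>.\<close>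

lemma drazin_invertible_imp_nilpotent:
  fixes b q :: "'a::complex_unital_banach_algebra"
  assumes q: "q * q = q" and bq: "b * q = q * b" and qn: "quasinilpotent (b * q)"
    and D: "drazin_invertible b"
  shows "\<exists>k\<ge>1. (b * q) ^ k = 0"
proof -
  obtain d m where d: "b * d = d * b" "d * b * d = d" "b ^ m * d * b = b ^ m"
    using D by (auto simp: drazin_invertible_def)
  have z: "q * (b * d) = 0"
    by (rule quasinilpotent_idempotent_times_inverse[OF q bq qn d(1,2)])
  have bm: "b ^ Suc m = b * d * b ^ Suc m"
  proof -
    have "b ^ Suc m = b ^ m * d * b * b"
      using d(3) by (simp add: power_commutes)
    also have "\<dots> = b * d * b ^ Suc m"
      using d(1) power_commuting_commutes[OF d(1), of m] power_commutes[of b m]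
      by (metis mult.assoc power_Suc power_Suc2)
    finally show ?thesis .
  qed
  have "(b * q) ^ Suc m = q * b ^ Suc m"
    using power_mult_idempotent[OF q bq] power_commuting_commutes[OF bq, of "Suc m"] by simp
  also have "\<dots> = q * (b * d) * b ^ Suc m"
    by (subst bm) (simp add: mult.assoc)
  also have "\<dots> = 0" using z by simp
  finally show ?thesis by (intro exI[of _ "Suc m"]) simp
qed

lemma not_invertible_if_quasinilpotent_part:
  fixes b q :: "'a::complex_unital_banach_algebra"
  assumes "q * q = q" "b * q = q * b" "quasinilpotent (b * q)" "q \<noteq> 0"
  shows "\<not> invertible_elem b"
proof
  assume "invertible_elem b"
  then obtain d where d: "b * d = 1" "d * b = 1" by (auto simp: invertible_elem_def)
  with quasinilpotent_idempotent_times_inverse[OF assms(1-3), of d] assms(4)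
  show False by simp
qed

lemma not_invertible_if_nilpotent_part:
  fixes b q :: "'a::ring_1"
  assumes "q * q = q" "b * q = q * b" "(b * q) ^ k = 0" "k \<ge> 1" "q \<noteq> 0"
  shows "\<not> invertible_elem b"
proof
  assume "invertible_elem b"
  then obtain d where d: "d * b = 1" by (auto simp: invertible_elem_def)
  have "b ^ k * q = 0"
    using assms power_mult_idempotent[OF assms(1,2), of "k - 1"] by simp
  moreover have "d ^ n * b ^ n = 1" for n
  proof (induction n)
    case (Suc n)
    have "d ^ Suc n * b ^ Suc n = d ^ n * (d * b) * b ^ n"
      by (simp only: power_Suc2[of d] power_Suc[of b] mult.assoc)
    thus ?case using d Suc by simp
  qed simp
  ultimately have "1 * q = 0" by (metis mult.assoc mult_zero_right)
  with assms(5) show False by simp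
qed

lemma corner_cutdown:
  assumes "y \<in> corner e" "e * e = e"
  shows "e * y = y" "y * e = y"
  using assms by (auto simp: corner_def) (metis mult.assoc)+

text \<open>If \<open>b\<close> commutes with the idempotent \<open>q\<close> and is invertible on the complementary corner,
  then its inverse there, extended by \<open>0\<close>, is a generalized inverse commuting with \<open>b\<close>.\<close>

lemma corner_inverse_is_generalized_inverse:
  fixes b q :: "'a::complex_unital_banach_algebra"
  assumes q: "q * q = q" and bq: "b * q = q * b"
    and inv: "corner_invertible (1 - q) ((1 - q) * b * (1 - q))"
  obtains c where "b * c = 1 - q" "c * b = 1 - q" "c * b * c = c"
proof -
  define f where "f = 1 - q"
  have f: "f * f = f" "b * f = f * b" using q bq by (simp_all add: f_def algebra_simps)
  obtain y where y: "y \<in> corner f" "f * b * f * y = f" "y * (f * b * f) = f"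
    using inv by (auto simp: corner_invertible_def f_def)
  have fy: "f * y = y" "y * f = y" using corner_cutdown[OF y(1) f(1)] .
  have "b * y = f * b * f * y" using fy f by (metis mult.assoc)
  moreover have "y * b = y * (f * b * f)" using fy f by (metis mult.assoc)
  ultimately show ?thesis using that[of y] y fy by (simp add: f_def)
qed

lemma koliha_drazin_invertible_if_split:
  fixes b q :: "'a::complex_unital_banach_algebra"
  assumes "q * q = q" "b * q = q * b" "corner_invertible (1 - q) ((1 - q) * b * (1 - q))"
    and "quasinilpotent (b * q)"
  shows "koliha_drazin_invertible b"
proof -
  obtain c where c: "b * c = 1 - q" "c * b = 1 - q" "c * b * c = c"
    by (rule corner_inverse_is_generalized_inverse[OF assms(1-3)])
  have "b * c * b = b + - (b * q)" using c(1) assms(2) by (simp add: left_diff_distrib)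
  thus ?thesis
    unfolding koliha_drazin_invertible_def using c quasinilpotent_minus[OF assms(4)] by metis
qed

lemma drazin_invertible_if_split:
  fixes b q :: "'a::complex_unital_banach_algebra"
  assumes "q * q = q" "b * q = q * b" "corner_invertible (1 - q) ((1 - q) * b * (1 - q))"
    and "(b * q) ^ k = 0" "k \<ge> 1"
  shows "drazin_invertible b"
proof -
  obtain c where c: "b * c = 1 - q" "c * b = 1 - q" "c * b * c = c"
    by (rule corner_inverse_is_generalized_inverse[OF assms(1-3)])
  have "b ^ k * q = 0"
    using assms power_mult_idempotent[OF assms(1,2), of "k - 1"] by simp
  hence "b ^ k * c * b = b ^ k" using c by (simp add: mult.assoc right_diff_distrib)
  thus ?thesis unfolding drazin_invertible_def using c by metis
qed

lemma corner_invertible_of_spectral_idempotent: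
  fixes b q :: "'a::complex_unital_banach_algebra"
  assumes q: "q * q = q" and bq: "b * q = q * b" and "invertible_elem (b + q)"
  shows "corner_invertible (1 - q) ((1 - q) * b * (1 - q))"
proof -
  obtain c where c: "(b + q) * c = 1" "c * (b + q) = 1"
    using assms(3) by (auto simp: invertible_elem_def)
  define f where "f = 1 - q"
  have f: "f * f = f" "b * f = f * b" using q bq by (simp_all add: f_def algebra_simps)
  have fb: "f * (b + q) = f * b" "(b + q) * f = f * b"
    using q bq by (simp_all add: f_def algebra_simps)
  have cf: "f * c = c * f"
    by (rule inverse_commutes[OF c]) (simp only: fb)
  have "(f * b * f) * (f * c * f) = f" "(f * c * f) * (f * b * f) = f"
  proof -
    have "(f * b * f) * (f * c * f) = f * ((b + q) * c)"
      using f fb cf by (metis mult.assoc)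
    thus "(f * b * f) * (f * c * f) = f" using c by simp
    have "(f * c * f) * (f * b * f) = (c * (b + q)) * f"
      using f fb cf by (metis mult.assoc)
    thus "(f * c * f) * (f * b * f) = f" using c by simp
  qed
  moreover have "f * u * f \<in> corner f" for u by (auto simp: corner_def)
  ultimately show ?thesis unfolding corner_invertible_def f_def by blast
qed

section \<open>Transfer along the homomorphism\<close>

theorem corollary3p3:
  fixes T :: "'a::complex_unital_banach_algebra \<Rightarrow> 'b::complex_unital_banach_algebra"
    and a :: 'a and b :: 'b
  assumes "algebra_hom T" and "T a = b"
  shows
    "(\<forall>p q. p * p = p \<and> p \<notin> hom_kernel T \<and> q = T p \<and>
        p * a * (1 - p) \<in> hom_kernel T \<and>
        (1 - p) * a * p \<in> hom_kernel T \<and>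
        (1 - p) * a * (1 - p) \<in> corner_fredholm T (1 - p) (1 - q) \<longrightarrow>
          (p * a * p \<in> riesz_elements T \<longrightarrow>
             koliha_drazin_invertible b \<and> \<not> invertible_elem b) \<and>
          (p * a * p \<in> hom_nilpotents T \<longrightarrow>
             drazin_invertible b \<and> \<not> invertible_elem b) \<and>
          (p * a * p \<in> riesz_elements T - hom_nilpotents T \<longrightarrow>
             koliha_drazin_invertible b \<and> \<not> drazin_invertible b))
     \<and>
     (\<forall>q. spectral_idempotent_at_0 b q \<longrightarrow>
        (\<forall>p. p * p = p \<and> T p = q \<longrightarrow>
          (koliha_drazin_invertible b \<and> \<not> invertible_elem b \<longrightarrow>
             p \<notin> hom_kernel T \<and>
             p * a * (1 - p) \<in> hom_kernel T \<and>
             (1 - p) * a * p \<in> hom_kernel T \<and>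
             (1 - p) * a * (1 - p) \<in> corner_fredholm T (1 - p) (1 - q) \<and>
             p * a * p \<in> riesz_elements T) \<and>
          (drazin_invertible b \<and> \<not> invertible_elem b \<longrightarrow>
             p \<notin> hom_kernel T \<and>
             p * a * (1 - p) \<in> hom_kernel T \<and>
             (1 - p) * a * p \<in> hom_kernel T \<and>
             (1 - p) * a * (1 - p) \<in> corner_fredholm T (1 - p) (1 - q) \<and>
             p * a * p \<in> hom_nilpotents T) \<and>
          (koliha_drazin_invertible b \<and> \<not> drazin_invertible b \<longrightarrow>
             p \<notin> hom_kernel T \<and>
             p * a * (1 - p) \<in> hom_kernel T \<and>
             (1 - p) * a * p \<in> hom_kernel T \<and>
             (1 - p) * a * (1 - p) \<in> corner_fredholm T (1 - p) (1 - q) \<and>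
             p * a * p \<in> riesz_elements T - hom_nilpotents T)))"
proof -
  have Tadd: "T (x + y) = T x + T y" and Tmult: "T (x * y) = T x * T y" and T1: "T 1 = 1" for x y
    using assms(1) by (simp_all add: algebra_hom_def)
  have Tdiff: "T (x - y) = T x - T y" for x y
    using Tadd[of "x - y" y] by (simp add: algebra_simps)
  have Tpow: "T (x ^ k) = T x ^ k" for x k
    by (induction k) (simp_all add: T1 Tmult)
  have Tcut: "T (p * a * (1 - p)) = q * b * (1 - q)" "T ((1 - p) * a * p) = (1 - q) * b * q"
    "T ((1 - p) * a * (1 - p)) = (1 - q) * b * (1 - q)" "T (p * a * p) = q * b * q"
    if "q = T p" for p q
    using that assms(2) by (simp_all add: Tmult Tdiff T1)
  have fred: "(1 - p) * a * (1 - p) \<in> corner_fredholm T (1 - p) (1 - q)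
      \<longleftrightarrow> corner_invertible (1 - q) ((1 - q) * b * (1 - q))" if "q = T p" for p q
    using Tcut(3)[OF that] by (auto simp: corner_fredholm_def corner_def)
  have idem: "q * q = q" if "p * p = p" "q = T p" for p q
    using that Tmult[of p p] by simp
  have cut: "q * b * q = b * q" if "q * q = q" "b * q = q * b" for q
    using that by (metis mult.assoc)
  have riesz: "p * a * p \<in> riesz_elements T \<longleftrightarrow> quasinilpotent (b * q)"
    and nil: "p * a * p \<in> hom_nilpotents T \<longleftrightarrow> (\<exists>k\<ge>1. (b * q) ^ k = 0)"
    if "q = T p" "q * q = q" "b * q = q * b" for p q
    using Tcut(4)[OF that(1)] cut[OF that(2,3)]
    by (simp_all add: riesz_elements_def hom_nilpotents_def hom_kernel_def Tpow)
  have offdiag: "p * a * (1 - p) \<in> hom_kernel T \<and> (1 - p) * a * p \<in> hom_kernel T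
      \<longleftrightarrow> b * q = q * b" if "q = T p" "q * q = q" for p q
  proof -
    have "b * q = q * b" if "q * b * (1 - q) = 0" "(1 - q) * b * q = 0"
      using that by (simp add: left_diff_distrib right_diff_distrib)
    moreover have "q * b * (1 - q) = 0 \<and> (1 - q) * b * q = 0" if "b * q = q * b"
      using that cut[OF \<open>q * q = q\<close> that] by (simp add: left_diff_distrib right_diff_distrib)
    ultimately show ?thesis
      using Tcut(1,2)[OF that(1)] by (auto simp: hom_kernel_def)
  qed
  show ?thesis (is "?A \<and> ?B")
  proof
    show ?A
    proof (intro allI impI, elim conjE)
      fix p q
      assume p: "p * p = p" "p \<notin> hom_kernel T" and qT: "q = T p"
        and off: "p * a * (1 - p) \<in> hom_kernel T" "(1 - p) * a * p \<in> hom_kernel T"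
        and fr: "(1 - p) * a * (1 - p) \<in> corner_fredholm T (1 - p) (1 - q)"
      have q: "q * q = q" by (rule idem[OF p(1) qT])
      have q0: "q \<noteq> 0" using p(2) qT by (simp add: hom_kernel_def)
      have bq: "b * q = q * b" using offdiag[OF qT q] off by blast
      have inv: "corner_invertible (1 - q) ((1 - q) * b * (1 - q))" using fred[OF qT] fr by blast
      note R = riesz[OF qT q bq] and N = nil[OF qT q bq]
      show "(p * a * p \<in> riesz_elements T \<longrightarrow>
             koliha_drazin_invertible b \<and> \<not> invertible_elem b) \<and>
          (p * a * p \<in> hom_nilpotents T \<longrightarrow>
             drazin_invertible b \<and> \<not> invertible_elem b) \<and>
          (p * a * p \<in> riesz_elements T - hom_nilpotents T \<longrightarrow>
             koliha_drazin_invertible b \<and> \<not> drazin_invertible b)"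
        using koliha_drazin_invertible_if_split[OF q bq inv]
          drazin_invertible_if_split[OF q bq inv]
          not_invertible_if_quasinilpotent_part[OF q bq _ q0]
          not_invertible_if_nilpotent_part[OF q bq _ _ q0]
          drazin_invertible_imp_nilpotent[OF q bq]
        unfolding Diff_iff R N by blast
    qed
    have main: "p \<notin> hom_kernel T \<and> p * a * (1 - p) \<in> hom_kernel T \<and>
             (1 - p) * a * p \<in> hom_kernel T \<and>
             (1 - p) * a * (1 - p) \<in> corner_fredholm T (1 - p) (1 - q) \<and>
             p * a * p \<in> riesz_elements T \<and>
             (p * a * p \<in> hom_nilpotents T \<longleftrightarrow> drazin_invertible b)"
      if s: "spectral_idempotent_at_0 b q" and Tp: "T p = q" for p q
    proof -
      have q: "q \<noteq> 0" "q * q = q" "b * q = q * b" "quasinilpotent (b * q)" "invertible_elem (b + q)"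
        using s by (auto simp: spectral_idempotent_at_0_def)
      note inv = corner_invertible_of_spectral_idempotent[OF q(2,3,5)]
      note qT = Tp[symmetric]
      have "p \<notin> hom_kernel T" using q Tp by (simp add: hom_kernel_def)
      moreover have "p * a * p \<in> hom_nilpotents T \<longleftrightarrow> drazin_invertible b"
        using nil[OF qT q(2,3)] drazin_invertible_imp_nilpotent[OF q(2-4)]
          drazin_invertible_if_split[OF q(2,3) inv] by blast
      ultimately show ?thesis
        using offdiag[OF qT q(2)] q(3,4) fred[OF qT] inv riesz[OF qT q(2,3)] by blast
    qed
    show ?B
      using main by blast
  qed
qed

end
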